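(* Let $\beta=(\beta_x,\beta_y)\in(0,+\infty)^2$, $z=(x,y)\in\mathcal Z$, and let $f\in\Gamma_0(\mathcal X)$ be differentiable with $L$-Lipschitz gradient. Then $$\mathcal K(z)\ \le\ \bar\beta_L\,\mathcal G_\beta(z),\qquad \bar\beta_L=\max\Big(\frac{2(L+\beta_x)^2}{\beta_x},\,2\beta_y\Big).$$
   Context: $\mathcal X,\mathcal Y$ are finite-dimensional Euclidean spaces, $\mathcal Z=\mathcal X\times\mathcal Y$. $\Gamma_0(\mathcal X)$ is the set of proper, lower semicontinuous, convex functions on $\mathcal X$; differentiable means that $f$ is finite and differentiable on all of $\mathcal X$. $A:\mathcal X\to\mathcal Y$ is linear with adjoint $A^T$, and $b\in\mathcal Y$. For differentiable $f$ the Karush-Kuhn-Tucker error is $\mathcal K(z)=\|\nabla f(x)+A^Ty\|^2+\|Ax-b\|^2$. The self-centered smoothed duality gap is $$\mathcal G_\beta(z)=f(x)-f(p)+\langle A(x-p),y\rangle-\tfrac{\beta_x}{2}\|p-x\|^2+\tfrac1{2\beta_y}\|Ax-b\|^2,\qquad p=\mathrm{Prox}_{\beta_x^{-1}f}\big(x-\tfrac1{\beta_x}A^Ty\big),$$ where $\mathrm{Prox}_{sf}(x)=\arg\min_{x'}f(x')+\frac1{2s}\|x'-x\|^2$. The saddle point problem $\min_x\max_y f(x)+\langle Ax-b,y\rangle$ is assumed throughout to have a solution. *)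

theory Defs
  imports "HOL-Analysis.Analysis"
begin

definition lower_semicont :: "('a::euclidean_space \<Rightarrow> ereal) \<Rightarrow> bool" where
  "lower_semicont f \<longleftrightarrow> (\<forall>x. f x \<le> Liminf (at x) f)"

definition proper :: "('a \<Rightarrow> ereal) \<Rightarrow> bool" where
  "proper f \<longleftrightarrow> (\<forall>x. f x \<noteq> -\<infinity>) \<and> (\<exists>x. f x \<noteq> \<infinity>)"

(* Convexity of the epigraph: this avoids the expression \<infinity> - \<infinity>, which a Jensen
   inequality over ereal could produce. *)
definition convex_ereal :: "('a::real_vector \<Rightarrow> ereal) \<Rightarrow> bool" where
  "convex_ereal f \<longleftrightarrow> convex {(x, r::real). f x \<le> ereal r}"

definition Gamma0 :: "('a::euclidean_space \<Rightarrow> ereal) set" where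
  "Gamma0 = {f. proper f \<and> lower_semicont f \<and> convex_ereal f}"

(* real_of_ereal sends infinite values to 0, so finiteness has to be required separately. *)
definition finite_differentiable :: "('a::euclidean_space \<Rightarrow> ereal) \<Rightarrow> bool" where
  "finite_differentiable f \<longleftrightarrow>
     (\<forall>x. \<bar>f x\<bar> \<noteq> \<infinity>) \<and> (\<forall>x. (\<lambda>u. real_of_ereal (f u)) differentiable at x)"

(* Meaningful only for f satisfying finite_differentiable. *)
definition gradient :: "('a::euclidean_space \<Rightarrow> ereal) \<Rightarrow> 'a \<Rightarrow> 'a" where
  "gradient f x = (THE D. GDERIV (\<lambda>u. real_of_ereal (f u)) x :> D)"

(* For f in Gamma0 and s > 0 the minimiser exists and is unique. *)
definition prox :: "real \<Rightarrow> ('a::euclidean_space \<Rightarrow> ereal) \<Rightarrow> 'a \<Rightarrow> 'a" where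
  "prox s f x = arg_min (\<lambda>x'. f x' + ereal (1 / (2 * s) * (norm (x' - x))\<^sup>2)) (\<lambda>_. True)"

definition lagrangian ::
  "('a::euclidean_space \<Rightarrow> ereal) \<Rightarrow> ('a \<Rightarrow> 'b::euclidean_space) \<Rightarrow> 'b \<Rightarrow> 'a \<Rightarrow> 'b \<Rightarrow> ereal" where
  "lagrangian f A b x y = f x + ereal ((A x - b) \<bullet> y)"

definition saddle_point ::
  "('a::euclidean_space \<Rightarrow> ereal) \<Rightarrow> ('a \<Rightarrow> 'b::euclidean_space) \<Rightarrow> 'b \<Rightarrow> 'a \<times> 'b \<Rightarrow> bool" where
  "saddle_point f A b = (\<lambda>(xs, ys).
     (\<forall>y. lagrangian f A b xs y \<le> lagrangian f A b xs ys) \<and>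
     (\<forall>x. lagrangian f A b xs ys \<le> lagrangian f A b x ys))"

definition kkt_error ::
  "('a::euclidean_space \<Rightarrow> ereal) \<Rightarrow> ('a \<Rightarrow> 'b::euclidean_space) \<Rightarrow> 'b \<Rightarrow> 'a \<times> 'b \<Rightarrow> real" where
  "kkt_error f A b = (\<lambda>(x, y). (norm (gradient f x + adjoint A y))\<^sup>2 + (norm (A x - b))\<^sup>2)"

definition smoothed_gap ::
  "('a::euclidean_space \<Rightarrow> ereal) \<Rightarrow> ('a \<Rightarrow> 'b::euclidean_space) \<Rightarrow> 'b
     \<Rightarrow> real \<times> real \<Rightarrow> 'a \<times> 'b \<Rightarrow> ereal" where
  "smoothed_gap f A b = (\<lambda>(\<beta>x, \<beta>y) (x, y).
     let p = prox (inverse \<beta>x) f (x - (1 / \<beta>x) *\<^sub>R adjoint A y)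
     in f x - f p + ereal (A (x - p) \<bullet> y - \<beta>x / 2 * (norm (p - x))\<^sup>2
                           + 1 / (2 * \<beta>y) * (norm (A x - b))\<^sup>2))"

end

theory Submission
  imports Defs
begin

text \<open>
  The gradient at the proximal point \<open>p\<close> satisfies
  \<open>\<nabla>f(p) + A\<^sup>T y = \<beta>x (x - p)\<close>.  Combined with the gradient inequality of \<open>f\<close> at \<open>p\<close>
  this bounds the gap from below by \<open>\<beta>x/2 \<parallel>x - p\<parallel>\<^sup>2 + \<parallel>Ax - b\<parallel>\<^sup>2 / (2 \<beta>y)\<close>; combined with the
  Lipschitz bound it gives \<open>\<parallel>\<nabla>f(x) + A\<^sup>T y\<parallel> \<le> (L + \<beta>x) \<parallel>x - p\<parallel>\<close>.
\<close>

text \<open>By Riesz representation: the adjoint of the derivative maps reals to vectors, and its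
  value at 1 is the representing vector.\<close>

lemma differentiable_imp_GDERIV:
  fixes g :: "'a::euclidean_space \<Rightarrow> real"
  assumes "g differentiable at x"
  shows "\<exists>D. GDERIV g x :> D"
proof -
  obtain g' where g': "(g has_derivative g') (at x)"
    using assms unfolding differentiable_def by blast
  then have "linear g'"
    by (rule has_derivative_linear)
  then have "g' = (\<lambda>h. h \<bullet> adjoint g' 1)"
    by (simp add: fun_eq_iff adjoint_works)
  then show ?thesis
    using g' unfolding gderiv_def by metis
qed

lemma GDERIV_unique:
  assumes "GDERIV g x :> D" "GDERIV g x :> E"
  shows "D = E"
proof -
  have "(\<lambda>h. h \<bullet> D) = (\<lambda>h. h \<bullet> E)"
    using assms unfolding gderiv_def by (rule has_derivative_unique)
  then show ?thesis
    by (metis vector_eq_ldot)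
qed

text \<open>Existence and uniqueness of the representing vector justify the \<open>THE\<close> in
  \<open>gradient\<close>.\<close>

lemma GDERIV_gradient:
  assumes "finite_differentiable f"
  shows "GDERIV (\<lambda>u. real_of_ereal (f u)) x :> gradient f x"
  unfolding gradient_def
proof (rule theI')
  show "\<exists>!D. GDERIV (\<lambda>u. real_of_ereal (f u)) x :> D"
    using assms differentiable_imp_GDERIV GDERIV_unique
    unfolding finite_differentiable_def by blast
qed

text \<open>Restricting \<open>g\<close> to the line through \<open>x\<close> and \<open>y\<close>
  reduces this to the tangent inequality for a convex function of one real variable, between
  parameters 0 and 1.\<close>

lemma convex_on_GDERIV_ge:
  fixes g :: "'a::real_inner \<Rightarrow> real"
  assumes "convex_on UNIV g" and D: "GDERIV g x :> D"
  shows "g x + (y - x) \<bullet> D \<le> g y"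
proof -
  define h where "h t = g (x + t *\<^sub>R (y - x))" for t :: real
  have "convex_on UNIV h"
  proof (rule convex_onI)
    fix t r s :: real
    assume t: "0 < t" "t < 1"
    have "x + ((1 - t) *\<^sub>R r + t *\<^sub>R s) *\<^sub>R (y - x)
        = (1 - t) *\<^sub>R (x + r *\<^sub>R (y - x)) + t *\<^sub>R (x + s *\<^sub>R (y - x))"
      by (simp add: algebra_simps)
    then show "h ((1 - t) *\<^sub>R r + t *\<^sub>R s) \<le> (1 - t) * h r + t * h s"
      unfolding h_def using convex_onD[OF assms(1), of t] t by simp
  qed simp
  moreover have "(h has_real_derivative (y - x) \<bullet> D) (at 0)"
  proof -
    have "(g has_derivative (\<lambda>h. h \<bullet> D)) (at (x + 0 *\<^sub>R (y - x)))"
      using D by (simp add: gderiv_def)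
    then have "((\<lambda>t. g (x + t *\<^sub>R (y - x))) has_derivative (\<lambda>t. (t *\<^sub>R (y - x)) \<bullet> D)) (at 0)"
      by (rule has_derivative_compose[rotated]) (auto intro!: derivative_eq_intros)
    then show ?thesis
      by (simp add: h_def[abs_def] has_field_derivative_def mult.commute[of _ "(y - x) \<bullet> D"])
  qed
  ultimately have "h 1 - h 0 \<ge> (y - x) \<bullet> D * (1 - 0)"
    by (intro convex_on_imp_above_tangent[where A = UNIV]) auto
  then show ?thesis
    by (simp add: h_def)
qed

lemma convex_ereal_imp_convex_on:
  assumes "convex_ereal (\<lambda>u. ereal (g u))"
  shows "convex_on UNIV g"
  using assms
  by (simp add: convex_ereal_def epigraph_def case_prod_unfold flip: convex_epigraph)

text \<open>The tangent of \<open>g\<close> at \<open>v\<close> decreases at most linearly, with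
  slope \<open>norm D\<close>, so the quadratic term outweighs it outside the ball of radius
  \<open>norm D / c\<close> about \<open>v\<close>. A minimiser over this compact ball is therefore
  global.\<close>

lemma proximal_minimizer_exists:
  fixes g :: "'a::euclidean_space \<Rightarrow> real"
  assumes "convex_on UNIV g" and diff: "\<And>x. g differentiable at x" and "c > 0"
  shows "\<exists>p. \<forall>u. g p + c * (norm (p - v))\<^sup>2 \<le> g u + c * (norm (u - v))\<^sup>2"
proof -
  let ?\<phi> = "\<lambda>u. g u + c * (norm (u - v))\<^sup>2"
  obtain D where D: "GDERIV g v :> D"
    using differentiable_imp_GDERIV diff by blast
  have "continuous_on (cball v (norm D / c)) g"
    using diff by (intro continuous_at_imp_continuous_on ballI differentiable_imp_continuous_within)
  then have "continuous_on (cball v (norm D / c)) ?\<phi>"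
    by (intro continuous_intros)
  moreover have "cball v (norm D / c) \<noteq> {}"
    using \<open>c > 0\<close> by (simp add: not_less)
  ultimately obtain p where p: "\<And>u. u \<in> cball v (norm D / c) \<Longrightarrow> ?\<phi> p \<le> ?\<phi> u"
    using continuous_attains_inf[OF compact_cball] by blast
  have "?\<phi> p \<le> ?\<phi> u" for u
  proof (cases "u \<in> cball v (norm D / c)")
    case False
    \<comment> \<open>Outside the ball the objective is at least \<open>g v\<close>, its value at
      the centre, which already bounds the minimum over the ball from above.\<close>
    then have "norm D \<le> c * norm (u - v)"
      using \<open>c > 0\<close> by (simp add: dist_norm norm_minus_commute field_simps)
    then have "norm (u - v) * norm D \<le> c * (norm (u - v))\<^sup>2"
      using mult_left_mono[OF _ norm_ge_zero[of "u - v"]] by (fastforce simp: power2_eq_square algebra_simps)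
    moreover have "- ((u - v) \<bullet> D) \<le> norm (u - v) * norm D"
      using Cauchy_Schwarz_ineq2[of "u - v" D] by linarith
    moreover have "g v + (u - v) \<bullet> D \<le> g u"
      using convex_on_GDERIV_ge assms(1) D .
    moreover have "?\<phi> p \<le> ?\<phi> v"
      using \<open>c > 0\<close> by (intro p) simp
    ultimately show ?thesis
      by simp
  qed (rule p)
  then show ?thesis
    by blast
qed

text \<open>\<open>arg_min\<close> is a Hilbert choice, so the minimising property of
  \<open>prox\<close> follows from the existence of some minimiser.\<close>

lemma prox_minimizes:
  fixes g :: "'a::euclidean_space \<Rightarrow> real" and v :: 'a
  assumes "convex_on UNIV g" "\<And>x. g differentiable at x" "s > 0"
  defines "p \<equiv> prox s (\<lambda>u. ereal (g u)) v"
  shows "g p + 1 / (2 * s) * (norm (p - v))\<^sup>2 \<le> g u + 1 / (2 * s) * (norm (u - v))\<^sup>2"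
proof -
  let ?\<phi> = "\<lambda>u. ereal (g u) + ereal (1 / (2 * s) * (norm (u - v))\<^sup>2)"
  obtain q where "\<And>u. g q + 1 / (2 * s) * (norm (q - v))\<^sup>2 \<le> g u + 1 / (2 * s) * (norm (u - v))\<^sup>2"
    using proximal_minimizer_exists[OF assms(1,2), of "1 / (2 * s)" v] \<open>s > 0\<close> by auto
  then have "is_arg_min ?\<phi> (\<lambda>_. True) q"
    by (simp add: is_arg_min_linorder)
  then have "is_arg_min ?\<phi> (\<lambda>_. True) p"
    unfolding p_def prox_def arg_min_def by (rule someI)
  then show ?thesis
    by (simp add: is_arg_min_linorder)
qed

text \<open>Fermat's rule: the derivative of the proximal objective vanishes at its
  minimiser.\<close>

lemma prox_optimality:
  fixes g :: "'a::euclidean_space \<Rightarrow> real" and v :: 'a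
  assumes "convex_on UNIV g" "\<And>x. g differentiable at x" "s > 0"
  defines "p \<equiv> prox s (\<lambda>u. ereal (g u)) v"
  assumes D: "GDERIV g p :> D"
  shows "D = (1 / s) *\<^sub>R (v - p)"
proof -
  \<comment> \<open>The square is written as an inner product because the norm itself is not
    differentiable at 0, and \<open>p = v\<close> may occur.\<close>
  let ?\<phi> = "\<lambda>u. g u + 1 / (2 * s) * ((u - v) \<bullet> (u - v))"
  have "(?\<phi> has_derivative (\<lambda>h. h \<bullet> D + 1 / (2 * s) * ((p - v) \<bullet> h + h \<bullet> (p - v)))) (at p)"
    using D[unfolded gderiv_def] \<open>s > 0\<close>
    by (auto intro!: derivative_eq_intros simp: field_simps)
  moreover have "\<forall>u\<in>UNIV. ?\<phi> p \<le> ?\<phi> u"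
    using prox_minimizes[OF assms(1-3)] by (simp add: p_def power2_norm_eq_inner)
  ultimately have "(\<lambda>h. h \<bullet> D + 1 / (2 * s) * ((p - v) \<bullet> h + h \<bullet> (p - v))) = (\<lambda>h. 0)"
    by (intro differential_zero_maxmin[of p UNIV ?\<phi>]) auto
  then have stat: "h \<bullet> D + 1 / (2 * s) * ((p - v) \<bullet> h + h \<bullet> (p - v)) = 0" for h
    by (rule fun_cong)
  have "h \<bullet> D = h \<bullet> ((1 / s) *\<^sub>R (v - p))" for h
    using stat[of h] \<open>s > 0\<close>
    by (simp add: inner_commute[of "p - v"] inner_diff_right diff_divide_distrib)
  then show ?thesis
    by (metis vector_eq_ldot)
qed

theorem theorem6:
  fixes f :: "'a::euclidean_space \<Rightarrow> ereal"
    and A :: "'a \<Rightarrow> 'b::euclidean_space"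
    and b :: 'b
    and \<beta>x \<beta>y L :: real
    and x :: 'a and y :: 'b
  assumes "linear A"
    and "\<exists>z. saddle_point f A b z"
    and "\<beta>x > 0" and "\<beta>y > 0"
    and "f \<in> Gamma0"
    and "finite_differentiable f"
    and "L-lipschitz_on UNIV (gradient f)"
  shows "ereal (kkt_error f A b (x, y))
           \<le> ereal (max (2 * (L + \<beta>x)\<^sup>2 / \<beta>x) (2 * \<beta>y)) * smoothed_gap f A b (\<beta>x, \<beta>y) (x, y)"
proof -
  define g where "g u = real_of_ereal (f u)" for u
  \<comment> \<open>Finiteness of \<open>f\<close> makes the passage to real values
    lossless.\<close>
  have f: "f = (\<lambda>u. ereal (g u))"
    using \<open>finite_differentiable f\<close>
    by (auto simp: fun_eq_iff g_def finite_differentiable_def ereal_real)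
  have diff: "g differentiable at u" for u
    using \<open>finite_differentiable f\<close> by (simp add: finite_differentiable_def g_def[abs_def])
  have conv: "convex_on UNIV g"
    using \<open>f \<in> Gamma0\<close> by (intro convex_ereal_imp_convex_on) (simp add: Gamma0_def f)
  have grad: "GDERIV g u :> gradient f u" for u
    using GDERIV_gradient[OF \<open>finite_differentiable f\<close>] by (simp add: g_def[abs_def])
  define w where "w = adjoint A y"
  define p where "p = prox (inverse \<beta>x) f (x - (1 / \<beta>x) *\<^sub>R w)"
  define M where "M = max (2 * (L + \<beta>x)\<^sup>2 / \<beta>x) (2 * \<beta>y)"

  have "gradient f p = (1 / inverse \<beta>x) *\<^sub>R (x - (1 / \<beta>x) *\<^sub>R w - p)"
    using prox_optimality[OF conv diff, of "inverse \<beta>x" "x - (1 / \<beta>x) *\<^sub>R w"] grad \<open>\<beta>x > 0\<close>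
    by (simp add: p_def f)
  then have opt: "gradient f p = \<beta>x *\<^sub>R (x - p) - w"
    using \<open>\<beta>x > 0\<close> by (simp add: scaleR_diff_right divide_inverse)

  have "g p + (x - p) \<bullet> gradient f p \<le> g x"
    using convex_on_GDERIV_ge[OF conv grad] .
  moreover have "A (x - p) \<bullet> y = (x - p) \<bullet> w"
    using adjoint_works[OF \<open>linear A\<close>] by (simp add: w_def)
  \<comment> \<open>By \<open>opt\<close>, \<open>(x - p) \<bullet> gradient f p\<close> is
    \<open>\<beta>x * (norm (x - p))\<^sup>2\<close> minus the coupling term. The proximal penalty
    in the gap consumes half of that square; the other half remains.\<close>
  ultimately have gap_x: "\<beta>x / 2 * (norm (x - p))\<^sup>2
      \<le> g x - g p + A (x - p) \<bullet> y - \<beta>x / 2 * (norm (p - x))\<^sup>2"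
    by (simp add: opt inner_diff_right norm_minus_commute[of p x] flip: power2_norm_eq_inner)

  \<comment> \<open>Solving \<open>opt\<close> for \<open>w\<close> brings in a difference of
    gradients, to which the Lipschitz bound applies.\<close>
  have "norm (gradient f x + w) = norm ((gradient f x - gradient f p) + \<beta>x *\<^sub>R (x - p))"
    by (simp add: opt)
  also have "\<dots> \<le> norm (gradient f x - gradient f p) + \<beta>x * norm (x - p)"
    using norm_triangle_ineq[of "gradient f x - gradient f p" "\<beta>x *\<^sub>R (x - p)"] \<open>\<beta>x > 0\<close> by simp
  also have "\<dots> \<le> (L + \<beta>x) * norm (x - p)"
    using lipschitz_onD[OF \<open>L-lipschitz_on UNIV (gradient f)\<close>, of x p]
    by (simp add: dist_norm algebra_simps)
  finally have "(norm (gradient f x + w))\<^sup>2 \<le> ((L + \<beta>x) * norm (x - p))\<^sup>2"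
    by (simp add: power_mono)
  \<comment> \<open>The first entry of the maximum is \<open>(L + \<beta>x)\<^sup>2\<close> divided
    by the coefficient \<open>\<beta>x / 2\<close> from \<open>gap_x\<close>; the second,
    \<open>2 * \<beta>y\<close>, inverts the feasibility coefficient of the gap.\<close>
  also have "\<dots> = 2 * (L + \<beta>x)\<^sup>2 / \<beta>x * (\<beta>x / 2 * (norm (x - p))\<^sup>2)"
    using \<open>\<beta>x > 0\<close> by (simp add: power_mult_distrib)
  also have "\<dots> \<le> M * (\<beta>x / 2 * (norm (x - p))\<^sup>2)"
    using \<open>\<beta>x > 0\<close> by (intro mult_right_mono) (auto simp: M_def)
  finally have kkt_x: "(norm (gradient f x + w))\<^sup>2 \<le> M * (\<beta>x / 2 * (norm (x - p))\<^sup>2)" .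
  have "(norm (A x - b))\<^sup>2 = 2 * \<beta>y * (1 / (2 * \<beta>y) * (norm (A x - b))\<^sup>2)"
    using \<open>\<beta>y > 0\<close> by simp
  also have "\<dots> \<le> M * (1 / (2 * \<beta>y) * (norm (A x - b))\<^sup>2)"
    using \<open>\<beta>y > 0\<close> by (intro mult_right_mono) (auto simp: M_def)
  finally have "kkt_error f A b (x, y)
      \<le> M * (\<beta>x / 2 * (norm (x - p))\<^sup>2 + 1 / (2 * \<beta>y) * (norm (A x - b))\<^sup>2)"
    using kkt_x by (simp add: kkt_error_def w_def distrib_left)
  also have "\<dots> \<le> M * (g x - g p + (A (x - p) \<bullet> y - \<beta>x / 2 * (norm (p - x))\<^sup>2
      + 1 / (2 * \<beta>y) * (norm (A x - b))\<^sup>2))"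
    \<comment> \<open>Multiplying by \<open>M\<close> preserves the inequality, since
      \<open>M\<close> is at least \<open>2 * \<beta>y\<close>, which is positive.\<close>
    using gap_x \<open>\<beta>y > 0\<close> by (intro mult_left_mono) (auto simp: M_def le_max_iff_disj)
  finally show ?thesis
    unfolding smoothed_gap_def M_def[symmetric] prod.case Let_def w_def[symmetric] p_def[symmetric]
    by (simp add: f)
qed

end
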